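(* For any integer $r\geq 3$ there are positive constants $c, c', d$ depending only on $r$ such that for every integer $\Delta > d$, $$c\, \frac{\Delta^{1/\lceil r/2 \rceil}}{\ln(\Delta)} \;\leq\; f(r, \Delta) \;\leq\; c'\, \Delta^{1/\lceil r/2 \rceil}.$$
   Context: A hypergraph $\mathcal{H}=(V,\mathcal{E})$ consists of a finite nonempty vertex set $V$ and a set $\mathcal{E}$ of nonempty subsets of $V$, called edges or hyperedges. It is $r$-uniform if each edge contains exactly $r$ vertices. The degree of a vertex is the number of edges containing it, and the maximum degree $\Delta(\mathcal{H})$ is the largest degree of a vertex. A vertex coloring of $\mathcal{H}$ is conflict-free if each edge $E$ contains a vertex whose color is assigned to no other vertex of $E$. The conflict-free chromatic number $\chi_{\mathrm{cf}}(\mathcal{H})$ is the minimum number of colors used in a conflict-free coloring of $\mathcal{H}$. Define $$f(r,\Delta)=\max\{\chi_{\mathrm{cf}}(\mathcal{H}) : \mathcal{H} \text{ is an } r\text{-uniform hypergraph with } \Delta(\mathcal{H})=\Delta\}.$$ *)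

theory Defs
  imports Complex_Main
begin

definition hypergraph :: "'a set \<Rightarrow> 'a set set \<Rightarrow> bool" where
  "hypergraph V E \<longleftrightarrow> finite V \<and> V \<noteq> {} \<and> (\<forall>e\<in>E. e \<noteq> {} \<and> e \<subseteq> V)"

definition uniform :: "nat \<Rightarrow> 'a set set \<Rightarrow> bool" where
  "uniform r E \<longleftrightarrow> (\<forall>e\<in>E. card e = r)"

definition degree :: "'a set set \<Rightarrow> 'a \<Rightarrow> nat" where
  "degree E v = card {e \<in> E. v \<in> e}"

definition max_degree :: "'a set \<Rightarrow> 'a set set \<Rightarrow> nat" where
  "max_degree V E = Max (degree E ` V)"

definition conflict_free :: "'a set set \<Rightarrow> ('a \<Rightarrow> 'c) \<Rightarrow> bool" where
  "conflict_free E col \<longleftrightarrow> (\<forall>e\<in>E. \<exists>v\<in>e. \<forall>w\<in>e. w \<noteq> v \<longrightarrow> col w \<noteq> col v)"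

text \<open>Vertex sets are finite, so natural numbers suffice as colors.\<close>

definition chi_cf :: "'a set \<Rightarrow> 'a set set \<Rightarrow> nat" where
  "chi_cf V E = (LEAST k. \<exists>col :: 'a \<Rightarrow> nat. conflict_free E col \<and> card (col ` V) = k)"

text \<open>
  A set of type \<^typ>\<open>nat\<close> contains a copy of every finite vertex set, so the maximum is
  taken over hypergraphs on natural numbers. The lemmas \<open>f_cf_attained\<close> and \<open>chi_cf_le_f_cf\<close>
  below show that for \<open>r \<ge> 2\<close> it exists and is the maximum over hypergraphs on every vertex type.
\<close>

definition f_cf :: "nat \<Rightarrow> nat \<Rightarrow> nat" where
  "f_cf r \<Delta> = Max {chi_cf V E | (V :: nat set) E.
     hypergraph V E \<and> uniform r E \<and> max_degree V E = \<Delta>}"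

lemma hypergraph_finite_edges: "hypergraph V E \<Longrightarrow> finite E"
  unfolding hypergraph_def by (rule finite_subset[of E "Pow V"]) auto

lemma degree_le_max_degree:
  assumes "hypergraph V E" "v \<in> V"
  shows "degree E v \<le> max_degree V E"
  using assms unfolding max_degree_def hypergraph_def by (intro Max_ge) auto

lemma chi_cf_le:
  fixes col :: "'a \<Rightarrow> nat"
  assumes "conflict_free E col"
  shows "chi_cf V E \<le> card (col ` V)"
  unfolding chi_cf_def by (rule Least_le) (use assms in blast)

lemma conflict_free_if_inj_on:
  assumes "hypergraph V E" "\<And>e. e \<in> E \<Longrightarrow> inj_on col e"
  shows "conflict_free E col"
  unfolding conflict_free_def
proof
  fix e assume e: "e \<in> E"
  then have "e \<noteq> {}" using assms(1) unfolding hypergraph_def by simp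
  then obtain v where v: "v \<in> e" by auto
  show "\<exists>v\<in>e. \<forall>w\<in>e. w \<noteq> v \<longrightarrow> col w \<noteq> col v"
    by (rule bexI[OF _ v]) (use v assms(2)[OF e] in \<open>simp add: inj_on_eq_iff\<close>)
qed

lemma chi_cf_attained:
  assumes "hypergraph V E"
  shows "\<exists>col :: 'a \<Rightarrow> nat. conflict_free E col \<and> card (col ` V) = chi_cf (V :: 'a set) E"
proof -
  obtain g :: "'a \<Rightarrow> nat" where g: "inj_on g V"
    using assms finite_imp_inj_to_nat_seg unfolding hypergraph_def by metis
  have "inj_on g e" if "e \<in> E" for e
    by (rule inj_on_subset[OF g]) (use assms that in \<open>simp add: hypergraph_def\<close>)
  then have "conflict_free E g" by (rule conflict_free_if_inj_on[OF assms])
  then have "\<exists>k. \<exists>col :: 'a \<Rightarrow> nat. conflict_free E col \<and> card (col ` V) = k" by blast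
  then show ?thesis unfolding chi_cf_def by (rule LeastI_ex)
qed

lemma rainbow_coloring:
  assumes H: "hypergraph V E" "uniform r E" and "W \<subseteq> V"
  shows "\<exists>col :: 'a \<Rightarrow> nat. col ` W \<subseteq> {..r * max_degree V E} \<and>
    (\<forall>e\<in>E. inj_on col (e \<inter> (W :: 'a set)))"
proof -
  have "finite W" using assms finite_subset unfolding hypergraph_def by blast
  then show ?thesis using \<open>W \<subseteq> V\<close>
  proof (induction W)
    case empty
    then show ?case by simp
  next
    case (insert x W)
    then obtain col :: "'a \<Rightarrow> nat" where
      col: "col ` W \<subseteq> {..r * max_degree V E}" "\<forall>e\<in>E. inj_on col (e \<inter> W)" by auto
    define N where "N = \<Union>{e \<in> E. x \<in> e}"
    have "card N \<le> (\<Sum>e\<in>{e \<in> E. x \<in> e}. card e)"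
      unfolding N_def by (rule card_Union_le_sum_card)
    also have "\<dots> = r * degree E x"
      using H(2) unfolding uniform_def degree_def by simp
    also have "\<dots> \<le> r * max_degree V E"
      using degree_le_max_degree[OF H(1), of x] insert.prems by simp
    finally have N: "card N \<le> r * max_degree V E" .
    have "finite N"
      using H(1) finite_subset[of N V] unfolding N_def hypergraph_def by auto
    have "\<not> {..r * max_degree V E} \<subseteq> col ` N"
    proof
      assume "{..r * max_degree V E} \<subseteq> col ` N"
      then have "card {..r * max_degree V E} \<le> card (col ` N)"
        using \<open>finite N\<close> by (intro card_mono) auto
      then show False using card_image_le[OF \<open>finite N\<close>, of col] N by simp
    qed
    then obtain k where k: "k \<le> r * max_degree V E" "k \<notin> col ` N" by auto
    have "inj_on (col(x := k)) (e \<inter> insert x W)" if "e \<in> E" for e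
    proof (cases "x \<in> e")
      case True
      then have "e \<subseteq> N" using that unfolding N_def by blast
      then show ?thesis using k(2) col(2) that unfolding inj_on_def by auto
    next
      case False
      then show ?thesis using col(2) that unfolding inj_on_def by auto
    qed
    moreover have "(col(x := k)) ` insert x W \<subseteq> {..r * max_degree V E}"
      using col(1) k(1) by auto
    ultimately show ?case by blast
  qed
qed

lemma chi_cf_bound:
  assumes "hypergraph V E" "uniform r E"
  shows "chi_cf (V :: 'a set) E \<le> r * max_degree V E + 1"
proof -
  obtain col :: "'a \<Rightarrow> nat" where col: "col ` V \<subseteq> {..r * max_degree V E}"
    "\<forall>e\<in>E. inj_on col (e \<inter> V)" using rainbow_coloring[OF assms, of V] by blast
  have "inj_on col e" if "e \<in> E" for e
  proof -
    have "e \<inter> V = e" using assms(1) that unfolding hypergraph_def by auto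
    then show ?thesis using bspec[OF col(2) that] by simp
  qed
  then have "conflict_free E col" by (rule conflict_free_if_inj_on[OF assms(1)])
  then have "chi_cf V E \<le> card (col ` V)" by (rule chi_cf_le)
  also have "\<dots> \<le> card {..r * max_degree V E}" using col(1) by (intro card_mono) auto
  finally show ?thesis by simp
qed

lemma finite_chi_cf_values:
  "finite {chi_cf V E | (V :: nat set) E. hypergraph V E \<and> uniform r E \<and> max_degree V E = \<Delta>}"
proof (rule finite_subset)
  show "{chi_cf V E | (V :: nat set) E. hypergraph V E \<and> uniform r E \<and> max_degree V E = \<Delta>}
    \<subseteq> {..r * \<Delta> + 1}"
    using chi_cf_bound[where 'a = nat and r = r] by fastforce
qed simp

lemma uniform_hypergraph_exists:
  assumes "r \<ge> 2"
  shows "\<exists>(V :: nat set) E. hypergraph V E \<and> uniform r E \<and> max_degree V E = \<Delta>"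
proof -
  define e where "e i = insert (0 :: nat) {i + 1..<i + r}" for i
  define E where "E = e ` {..<\<Delta>}"
  have H: "hypergraph {..\<Delta> + r} E"
    unfolding hypergraph_def E_def e_def by auto
  have U: "uniform r E"
    using assms unfolding uniform_def E_def e_def by auto
  have "inj e"
  proof (rule injI)
    fix i j assume "e i = e j"
    moreover have "i + 1 \<in> e i" "j + 1 \<in> e j" using assms unfolding e_def by auto
    ultimately have "i + 1 \<in> e j" "j + 1 \<in> e i" by auto
    then show "i = j" unfolding e_def by auto
  qed
  then have cE: "card E = \<Delta>" unfolding E_def by (simp add: card_image inj_on_subset)
  have "{x \<in> E. 0 \<in> x} = E" unfolding E_def e_def by auto
  then have 0: "degree E 0 = \<Delta>" using cE unfolding degree_def by simp
  have "degree E v \<le> \<Delta>" for v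
    using card_mono[of E "{x \<in> E. v \<in> x}"] cE hypergraph_finite_edges[OF H]
    unfolding degree_def by auto
  then have "max_degree {..\<Delta> + r} E = \<Delta>"
    unfolding max_degree_def by (intro Max_eqI) (use 0 in auto)
  then show ?thesis using H U by blast
qed

lemma f_cf_attained:
  assumes "r \<ge> 2"
  shows "\<exists>(V :: nat set) E. hypergraph V E \<and> uniform r E \<and> max_degree V E = \<Delta> \<and>
    chi_cf V E = f_cf r \<Delta>"
proof -
  let ?S = "{chi_cf V E | (V :: nat set) E. hypergraph V E \<and> uniform r E \<and> max_degree V E = \<Delta>}"
  obtain V E where "hypergraph (V :: nat set) E" "uniform r E" "max_degree V E = \<Delta>"
    using uniform_hypergraph_exists[OF assms, of \<Delta>] by (elim exE conjE)
  then have "chi_cf V E \<in> ?S" by (intro CollectI exI[of _ V] exI[of _ E]) simp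
  then have "?S \<noteq> {}" by (rule ex_in_conv[THEN iffD1, OF exI])
  with finite_chi_cf_values have "Max ?S \<in> ?S" by (rule Max_in)
  then obtain V E where "f_cf r \<Delta> = chi_cf V E" "hypergraph (V :: nat set) E"
    "uniform r E" "max_degree V E = \<Delta>" unfolding f_cf_def by (elim CollectE exE conjE)
  then show ?thesis by (intro exI conjI) simp_all
qed

lemma chi_cf_le_f_cf:
  assumes H: "hypergraph (V :: 'a set) E" and U: "uniform r E" and D: "max_degree V E = \<Delta>"
  shows "chi_cf V E \<le> f_cf r \<Delta>"
proof -
  obtain g :: "'a \<Rightarrow> nat" where g: "inj_on g V"
    using H finite_imp_inj_to_nat_seg unfolding hypergraph_def by metis
  define V' where "V' = g ` V"
  define E' where "E' = (`) g ` E"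
  have sub: "e \<subseteq> V" if "e \<in> E" for e using H that unfolding hypergraph_def by blast
  have H': "hypergraph V' E'"
    using H unfolding hypergraph_def V'_def E'_def by auto
  have U': "uniform r E'"
    using U card_image[OF inj_on_subset[OF g sub]] unfolding uniform_def E'_def by simp
  have inj: "inj_on ((`) g) E"
    using inj_on_image_Pow[OF g] sub by (auto intro: inj_on_subset)
  have deg: "degree E' (g v) = degree E v" if "v \<in> V" for v
  proof -
    have "g v \<in> g ` e \<longleftrightarrow> v \<in> e" if "e \<in> E" for e
      by (rule inj_on_image_mem_iff[OF g \<open>v \<in> V\<close> sub[OF that]])
    then have "{e' \<in> E'. g v \<in> e'} = (`) g ` {e \<in> E. v \<in> e}"
      unfolding E'_def by auto
    moreover have "inj_on ((`) g) {e \<in> E. v \<in> e}" using inj by (auto intro: inj_on_subset)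
    ultimately show ?thesis unfolding degree_def by (simp add: card_image)
  qed
  have "degree E' ` V' = degree E ` V"
    unfolding V'_def image_image using deg by (intro image_cong) auto
  then have D': "max_degree V' E' = \<Delta>" using D unfolding max_degree_def by simp
  obtain col :: "nat \<Rightarrow> nat" where col: "conflict_free E' col" "card (col ` V') = chi_cf V' E'"
    using chi_cf_attained[OF H'] by blast
  have "conflict_free E (col \<circ> g)"
    unfolding conflict_free_def
  proof
    fix e assume e: "e \<in> E"
    then have "g ` e \<in> E'" unfolding E'_def by simp
    then obtain v where v: "v \<in> e" "\<forall>w\<in>g ` e. w \<noteq> g v \<longrightarrow> col w \<noteq> col (g v)"
      using col(1) unfolding conflict_free_def by (metis imageE)
    have "g w \<noteq> g v" if "w \<in> e" "w \<noteq> v" for w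
      using inj_on_eq_iff[OF inj_on_subset[OF g sub[OF e]] that(1) v(1)] that(2) by simp
    then show "\<exists>v\<in>e. \<forall>w\<in>e. w \<noteq> v \<longrightarrow> (col \<circ> g) w \<noteq> (col \<circ> g) v"
      using v by auto
  qed
  then have "chi_cf V E \<le> card ((col \<circ> g) ` V)" by (rule chi_cf_le)
  also have "\<dots> = chi_cf V' E'" using col(2) unfolding V'_def image_comp .
  also have "\<dots> \<le> f_cf r \<Delta>"
    unfolding f_cf_def using H' U' D'
    by (intro Max_ge[OF finite_chi_cf_values] CollectI exI[of _ V'] exI[of _ E']) simp
  finally show ?thesis .
qed

end

theory Submission
  imports Defs "HOL-Library.FuncSet"
begin

text \<open>
  Write \<open>t = \<lceil>r/2\<rceil>\<close>. Both bounds are obtained with order \<open>\<Delta>\<^sup>1\<^sup>/\<^sup>t\<close>, and \<open>ln \<Delta> \<ge> 1\<close> gives the lower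
  bound in the form with a logarithm.

  Upper bound. If a coloring is not conflict-free on an edge with \<open>r\<close> vertices, every color of that
  edge occurs at least twice, so at least \<open>t\<close> of the vertices copy the color of one of the
  others (\<open>repeated_colors_copying\<close>). Hence for colors chosen at random among \<open>2b\<close>, an
  edge is bad with probability of order \<open>b\<^sup>-\<^sup>t\<close>, and each vertex is in at most \<open>\<Delta>\<close> edges.
  Instead of the local lemma, a counting induction is used: when vertices are
  colored one at a time, each new vertex multiplies the number of conflict-free colorings by at
  least \<open>b\<close>. Indeed it has \<open>2b\<close> possible colors, and once it is fixed which \<open>t\<close> vertices of an edge
  copy which others, a bad extension is determined by its restriction to the vertices that do not
  copy; the new vertex is among the copying ones, so by induction there are fewer such
  restrictions than colorings to be extended, by a factor of at least \<open>b\<^sup>t\<^sup>-\<^sup>1\<close>. So the bad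
  extensions amount to at most \<open>b\<close> per coloring as soon as \<open>\<Delta>\<close>, times a constant for the ways to
  copy, is at most \<open>b\<^sup>t\<close> (\<open>good_colorings_grow\<close>).

  Lower bound. On the vertices \<open>0, \<dots>, n - 1\<close> the edges consist of \<open>\<lfloor>r/2\<rfloor>\<close> pairs with one common
  sum, and of one arbitrary further vertex if \<open>r\<close> is odd. Two distinct pairs with the same sum are
  disjoint, and an edge through a given vertex has \<open>t\<close> free parameters, so the degrees are
  at most \<open>4 n\<^sup>t\<close> (\<open>degree_sum_edges\<close>). If there are fewer than \<open>n\<close> colors by a large constant
  factor, then there are many more monochromatic pairs than possible sums, hence \<open>\<lfloor>r/2\<rfloor>\<close> of them
  share a sum; the further vertex can take the color of one of the pairs. In the resulting
  edge every color is repeated (\<open>sum_edges_few_colors\<close>).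
\<close>

section \<open>Edges on which every color is repeated\<close>

text \<open>
  Choose one representative of each color, different from \<open>v\<close>. As each color occurs twice, at most
  half of the vertices are representatives, and each of the others has the color of one.
\<close>

lemma repeated_colors_copying:
  fixes col :: "'a \<Rightarrow> 'c"
  assumes fin: "finite e" and v: "v \<in> e"
    and rep: "\<And>x. x \<in> e \<Longrightarrow> \<exists>w\<in>e. w \<noteq> x \<and> col w = col x"
  shows "\<exists>T g. T \<subseteq> e \<and> v \<in> T \<and> card T = (card e + 1) div 2 \<and> g \<in> e \<rightarrow>\<^sub>E e \<and>
    (\<forall>x\<in>T. g x \<notin> T \<and> col (g x) = col x)"
proof -
  have "\<forall>c\<in>col ` e. \<exists>x. x \<in> e \<and> x \<noteq> v \<and> col x = c"
  proof
    fix c assume "c \<in> col ` e"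
    then obtain x where x: "x \<in> e" "col x = c" by auto
    then obtain w where "w \<in> e" "w \<noteq> x" "col w = col x" using rep by blast
    then show "\<exists>x. x \<in> e \<and> x \<noteq> v \<and> col x = c" using x by metis
  qed
  then obtain \<rho> where \<rho>: "\<And>c. c \<in> col ` e \<Longrightarrow> \<rho> c \<in> e \<and> \<rho> c \<noteq> v \<and> col (\<rho> c) = c"
    by metis
  define R where "R = \<rho> ` col ` e"
  have R: "R \<subseteq> e" "v \<notin> R" using \<rho> unfolding R_def by auto
  have "inj_on \<rho> (col ` e)" using \<rho> by (metis inj_onI)
  then have cR: "card R = card (col ` e)" unfolding R_def by (rule card_image)
  have R_unique: "x = y" if "x \<in> R" "y \<in> R" "col x = col y" for x y
    using that \<rho> unfolding R_def by force
  have "col ` e \<subseteq> col ` (e - R)"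
  proof
    fix c assume c: "c \<in> col ` e"
    then obtain w where "w \<in> e" "w \<noteq> \<rho> c" "col w = c" using \<rho>[OF c] rep by metis
    moreover from this have "w \<notin> R" using R_unique[of w "\<rho> c"] \<rho>[OF c] c unfolding R_def by auto
    ultimately show "c \<in> col ` (e - R)" by blast
  qed
  then have "card (col ` e) \<le> card (col ` (e - R))" using fin by (intro card_mono) auto
  also have "\<dots> \<le> card (e - R)" using fin by (intro card_image_le) auto
  finally have "card R \<le> card (e - R)" using cR by simp
  moreover have "card (e - R) = card e - card R"
    using R fin by (meson card_Diff_subset finite_subset)
  moreover have "card e \<ge> 1" using v fin by (metis One_nat_def Suc_leI card_gt_0_iff empty_iff)
  ultimately have "(card e + 1) div 2 \<le> card (e - R)" "card {v} \<le> (card e + 1) div 2" by auto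
  then obtain T where T: "{v} \<subseteq> T" "T \<subseteq> e - R" "card T = (card e + 1) div 2"
    using exists_subset_between[of "{v}" "(card e + 1) div 2" "e - R"] v R fin by auto
  define g where "g = restrict (\<rho> \<circ> col) e"
  have "g \<in> e \<rightarrow>\<^sub>E e" using \<rho> unfolding g_def by auto
  moreover have "g x \<notin> T \<and> col (g x) = col x" if "x \<in> T" for x
  proof -
    have "x \<in> e" using that T by auto
    then have "g x \<in> R" "col (g x) = col x" using \<rho> unfolding g_def R_def by auto
    then show ?thesis using T by auto
  qed
  ultimately show ?thesis using T by (intro exI[of _ T] exI[of _ g]) auto
qed

section \<open>The upper bound by counting colorings\<close>

definition good_colorings :: "'a set set \<Rightarrow> nat \<Rightarrow> 'a set \<Rightarrow> ('a \<Rightarrow> nat) set" where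
  "good_colorings E k W = {f \<in> W \<rightarrow>\<^sub>E {..<k}. conflict_free {e \<in> E. e \<subseteq> W} f}"

lemma finite_good_colorings: "finite W \<Longrightarrow> finite (good_colorings E k W)"
  unfolding good_colorings_def
  by (rule finite_subset[of _ "W \<rightarrow>\<^sub>E {..<k}"]) (auto intro: finite_PiE)

lemma restrict_good_colorings:
  assumes "f \<in> good_colorings E k W" "U \<subseteq> W"
  shows "restrict f U \<in> good_colorings E k U"
proof -
  have "conflict_free {e \<in> E. e \<subseteq> U} (restrict f U)"
    unfolding conflict_free_def
  proof
    fix e assume e: "e \<in> {e \<in> E. e \<subseteq> U}"
    then obtain v where v: "v \<in> e" "\<forall>w\<in>e. w \<noteq> v \<longrightarrow> f w \<noteq> f v"
      using assms unfolding good_colorings_def conflict_free_def by blast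
    have "restrict f U w = f w" if "w \<in> e" for w using that e by auto
    then show "\<exists>v\<in>e. \<forall>w\<in>e. w \<noteq> v \<longrightarrow> restrict f U w \<noteq> restrict f U v"
      using v by (metis (no_types))
  qed
  then show ?thesis using assms unfolding good_colorings_def by auto
qed

text \<open>
  All extensions to one more vertex \<open>v\<close> of a good coloring; such an extension fails to be good
  only because of edges through \<open>v\<close>.
\<close>

definition extensions :: "'a set set \<Rightarrow> nat \<Rightarrow> 'a set \<Rightarrow> 'a \<Rightarrow> ('a \<Rightarrow> nat) set" where
  "extensions E k W v = {f \<in> insert v W \<rightarrow>\<^sub>E {..<k}. restrict f W \<in> good_colorings E k W}"

lemma card_extensions:
  assumes "finite W" "v \<notin> W"
  shows "card (extensions E k W v) = k * card (good_colorings E k W)"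
proof -
  have "bij_betw (\<lambda>(f, c). f(v := c)) (good_colorings E k W \<times> {..<k}) (extensions E k W v)"
  proof (rule bij_betwI[where g = "\<lambda>f. (restrict f W, f v)"])
    have ext: "restrict (f(v := c)) W = f" if "f \<in> good_colorings E k W" for f c
      using that assms unfolding good_colorings_def by (auto simp: fun_eq_iff PiE_def extensional_def)
    show "(\<lambda>(f, c). f(v := c)) \<in> good_colorings E k W \<times> {..<k} \<rightarrow> extensions E k W v"
      using ext unfolding extensions_def
      by (auto simp: good_colorings_def intro!: PiE_I split: if_splits)
    show "(\<lambda>f. (restrict f W, f v)) \<in> extensions E k W v \<rightarrow> good_colorings E k W \<times> {..<k}"
      unfolding extensions_def by auto
    show "(restrict (case x of (f, c) \<Rightarrow> f(v := c)) W, (case x of (f, c) \<Rightarrow> f(v := c)) v) = x"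
      if "x \<in> good_colorings E k W \<times> {..<k}" for x
    proof -
      obtain f c where x: "x = (f, c)" by fastforce
      then have "f \<in> good_colorings E k W" using that by simp
      then show ?thesis using ext unfolding x by simp
    qed
    show "(case (restrict f W, f v) of (f, c) \<Rightarrow> f(v := c)) = f" if "f \<in> extensions E k W v" for f
      using that unfolding extensions_def by (auto simp: fun_eq_iff PiE_def extensional_def)
  qed
  then have "card (extensions E k W v) = card (good_colorings E k W \<times> {..<k})"
    by (metis bij_betw_same_card)
  then show ?thesis by (simp add: card_cartesian_product)
qed

text \<open>
  Erasing the colors on \<open>T\<close> loses no information when they are copied from outside \<open>T\<close>.
\<close>

lemma card_copying_extensions:
  assumes "finite W" "v \<in> T" "T \<subseteq> insert v W" "v \<notin> W"
    and g: "\<And>x. x \<in> T \<Longrightarrow> g x \<in> insert v W - T"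
  shows "card {f \<in> extensions E k W v. \<forall>x\<in>T. f (g x) = f x} \<le> card (good_colorings E k (W - T))"
    (is "card ?B \<le> _")
proof (rule card_inj_on_le[where f = "\<lambda>f. restrict f (W - T)"])
  show "finite (good_colorings E k (W - T))" using assms by (simp add: finite_good_colorings)
  show "(\<lambda>f. restrict f (W - T)) ` ?B \<subseteq> good_colorings E k (W - T)"
  proof
    fix h assume "h \<in> (\<lambda>f. restrict f (W - T)) ` ?B"
    then obtain f where f: "restrict f W \<in> good_colorings E k W" "h = restrict f (W - T)"
      unfolding extensions_def by auto
    have "h = restrict (restrict f W) (W - T)" unfolding f(2) by (auto simp: fun_eq_iff)
    then show "h \<in> good_colorings E k (W - T)"
      using restrict_good_colorings[OF f(1), of "W - T"] by auto
  qed
  show "inj_on (\<lambda>f. restrict f (W - T)) ?B"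
  proof (rule inj_onI)
    fix f h assume f: "f \<in> ?B" and h: "h \<in> ?B"
      and eq: "restrict f (W - T) = restrict h (W - T)"
    have off: "f x = h x" if "x \<in> W - T" for x
      using that fun_cong[OF eq, of x] by simp
    have on: "f x = h x" if "x \<in> T" for x
    proof -
      have "g x \<in> W - T" using g[OF that] assms by auto
      then show ?thesis using off f h that by force
    qed
    show "f = h"
    proof
      fix x
      show "f x = h x"
      proof (cases "x \<in> insert v W")
        case True
        then show ?thesis using on off assms by blast
      next
        case False
        then show ?thesis using f h unfolding extensions_def PiE_def extensional_def by auto
      qed
    qed
  qed
qed

text \<open>
  The bound is for deleting a set \<open>S\<close> of vertices, and not just one, because the step for the
  vertex \<open>v\<close> compares with colorings that omit the whole set of copying vertices.
\<close>

lemma good_colorings_grow: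
  assumes H: "hypergraph V E" "uniform r E" and deg: "\<And>v. v \<in> V \<Longrightarrow> degree E v \<le> \<Delta>"
    and b: "b \<ge> 1" "\<Delta> * (2 ^ r * r ^ r) \<le> b ^ ((r + 1) div 2)"
    and "W \<subseteq> V" "S \<subseteq> W"
  shows "b ^ card S * card (good_colorings E (2 * b) (W - S)) \<le> card (good_colorings E (2 * b) W)"
proof -
  let ?P = "good_colorings E (2 * b)"
  define t where "t = (r + 1) div 2"
  have "finite W" using assms finite_subset unfolding hypergraph_def by blast
  then show ?thesis using \<open>W \<subseteq> V\<close> \<open>S \<subseteq> W\<close>
  proof (induction W arbitrary: S rule: finite_psubset_induct)
    case (psubset W)
    show ?case
    proof (cases "S = {}")
      case True
      then show ?thesis by simp
    next
      case False
      then obtain v where v: "v \<in> S" by auto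
      define U where "U = W - {v}"
      have U: "finite U" "v \<notin> U" "insert v U = W" "U \<subset> W" "U \<subseteq> V" "v \<in> V"
        using psubset v unfolding U_def by auto
      define Ev where "Ev = {e \<in> E. v \<in> e \<and> e \<subseteq> W}"
      define C where "C e = Pow e \<times> (e \<rightarrow>\<^sub>E e)" for e :: "'a set"
      define D where "D e = {(T, g) \<in> C e. v \<in> T \<and> card T = t \<and> (\<forall>x\<in>T. g x \<notin> T)}" for e
      define B where "B = (\<lambda>(T, g). {f \<in> extensions E (2 * b) U v. \<forall>x\<in>T. f (g x) = f x})"
      have edge: "finite e \<and> card e = r" if "e \<in> Ev" for e
        using that H finite_subset[of e V] unfolding Ev_def uniform_def hypergraph_def by auto
      have C: "finite (C e) \<and> card (C e) = 2 ^ r * r ^ r" if "e \<in> Ev" for e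
        using edge[OF that] unfolding C_def
        by (auto simp: card_cartesian_product card_Pow card_funcsetE intro: finite_PiE)
      have D: "finite (D e) \<and> card (D e) \<le> 2 ^ r * r ^ r" if "e \<in> Ev" for e
      proof -
        have "D e \<subseteq> C e" unfolding D_def by auto
        then show ?thesis using C[OF that] by (metis card_mono finite_subset)
      qed
      have finEv: "finite Ev" using hypergraph_finite_edges[OF H(1)] unfolding Ev_def by auto
      have "card Ev \<le> degree E v"
        unfolding Ev_def degree_def using hypergraph_finite_edges[OF H(1)]
        by (intro card_mono) auto
      then have Ev: "card Ev \<le> \<Delta>" using deg[of v] U by linarith
      \<comment> \<open>\<open>D e\<close> lists the ways to copy within \<open>e\<close>, and \<open>B d\<close> the extensions that copy as \<open>d\<close> says.\<close>
      have cover: "extensions E (2 * b) U v \<subseteq> ?P W \<union> (\<Union>e\<in>Ev. \<Union>d\<in>D e. B d)"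
      proof
        fix f assume f: "f \<in> extensions E (2 * b) U v"
        show "f \<in> ?P W \<union> (\<Union>e\<in>Ev. \<Union>d\<in>D e. B d)"
        proof (cases "f \<in> ?P W")
          case False
          have "f \<in> W \<rightarrow>\<^sub>E {..<2 * b}" using f U unfolding extensions_def by auto
          then have "\<not> conflict_free {e \<in> E. e \<subseteq> W} f"
            using False unfolding good_colorings_def by auto
          then obtain e where e: "e \<in> E" "e \<subseteq> W"
            and rep: "\<And>x. x \<in> e \<Longrightarrow> \<exists>w\<in>e. w \<noteq> x \<and> f w = f x"
            unfolding conflict_free_def by blast
          have "v \<in> e"
          proof (rule ccontr)
            assume "v \<notin> e"
            then have sub: "e \<subseteq> U" using e U by auto
            have "conflict_free {e \<in> E. e \<subseteq> U} (restrict f U)"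
              using f unfolding extensions_def good_colorings_def by auto
            then obtain x where "x \<in> e" "\<forall>w\<in>e. w \<noteq> x \<longrightarrow> restrict f U w \<noteq> restrict f U x"
              using e sub unfolding conflict_free_def by blast
            then show False using rep[of x] sub by (metis restrict_apply' subsetD)
          qed
          then have eEv: "e \<in> Ev" using e unfolding Ev_def by auto
          obtain T g where "T \<subseteq> e" "v \<in> T" "card T = (card e + 1) div 2" "g \<in> e \<rightarrow>\<^sub>E e"
            and Tg: "\<forall>x\<in>T. g x \<notin> T \<and> f (g x) = f x"
            using repeated_colors_copying[OF _ \<open>v \<in> e\<close> rep] edge[OF eEv] by (elim exE conjE) auto
          then have "(T, g) \<in> D e" using edge[OF eEv] unfolding D_def C_def t_def by auto
          moreover have "f \<in> B (T, g)" using f Tg unfolding B_def by auto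
          ultimately show ?thesis using eEv by blast
        qed simp
      qed
      \<comment> \<open>The induction hypothesis is for \<open>U\<close> and the \<open>t - 1\<close> copying vertices other than \<open>v\<close>.\<close>
      have step: "b ^ (t - 1) * card (B d) \<le> card (?P U)" if "e \<in> Ev" "d \<in> D e" for e d
      proof -
        obtain T g where d: "d = (T, g)" by fastforce
        have Tg: "v \<in> T" "T \<subseteq> e" "card T = t" "g \<in> e \<rightarrow>\<^sub>E e" "\<forall>x\<in>T. g x \<notin> T" "e \<subseteq> W"
          using that unfolding d D_def C_def Ev_def by auto
        have "g x \<in> insert v U - T" if "x \<in> T" for x
          using Tg that U by auto
        then have "card (B d) \<le> card (?P (U - T))"
          using card_copying_extensions[OF U(1) Tg(1) _ U(2), of g E "2 * b"] Tg U
          unfolding d B_def by auto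
        moreover have "b ^ card (T - {v}) * card (?P (U - (T - {v}))) \<le> card (?P U)"
          using Tg U by (intro psubset.IH) auto
        moreover have "card (T - {v}) = t - 1" using Tg by (simp add: card_Diff_singleton)
        moreover have "U - (T - {v}) = U - T" using U by auto
        ultimately show ?thesis by (metis mult_le_mono2 order_trans)
      qed
      define bad where "bad = (\<Union>e\<in>Ev. \<Union>d\<in>D e. B d)"
      have "b ^ (t - 1) * card bad \<le> b ^ (t - 1) * (\<Sum>e\<in>Ev. \<Sum>d\<in>D e. card (B d))"
        unfolding bad_def using finEv D
        by (intro mult_le_mono2 order_trans[OF card_UN_le] sum_mono card_UN_le) auto
      also have "\<dots> = (\<Sum>e\<in>Ev. \<Sum>d\<in>D e. b ^ (t - 1) * card (B d))"
        by (simp add: sum_distrib_left)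
      also have "\<dots> \<le> (\<Sum>e\<in>Ev. \<Sum>d\<in>D e. card (?P U))"
        using step by (intro sum_mono) auto
      also have "\<dots> \<le> (\<Sum>e\<in>Ev. 2 ^ r * r ^ r * card (?P U))"
        using D by (intro sum_mono) simp
      also have "\<dots> \<le> \<Delta> * (2 ^ r * r ^ r) * card (?P U)" using Ev by simp
      also have "\<dots> \<le> b ^ t * card (?P U)" using b unfolding t_def by simp
      also have "\<dots> \<le> b ^ (t - 1) * (b * card (?P U))"
        using b(1) by (cases t) auto
      finally have bad: "card bad \<le> b * card (?P U)" using b(1) by simp
      have finP: "finite (?P W)" using psubset.hyps by (simp add: finite_good_colorings)
      have "finite (extensions E (2 * b) U v)"
        unfolding extensions_def
        by (rule finite_subset[of _ "insert v U \<rightarrow>\<^sub>E {..<2 * b}"]) (use U in \<open>auto intro: finite_PiE\<close>)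
      then have "finite bad" unfolding bad_def B_def using finEv D by auto
      have "2 * b * card (?P U) = card (extensions E (2 * b) U v)"
        using card_extensions[OF U(1,2)] by simp
      also have "\<dots> \<le> card (?P W \<union> bad)"
        using cover finP \<open>finite bad\<close> unfolding bad_def by (intro card_mono) auto
      also have "\<dots> \<le> card (?P W) + card bad" by (rule card_Un_le)
      finally have one: "b * card (?P U) \<le> card (?P W)" using bad by linarith
      have "b ^ card (S - {v}) * card (?P (U - (S - {v}))) \<le> card (?P U)"
        using U psubset.prems by (intro psubset.IH) auto
      moreover have "U - (S - {v}) = W - S" using v unfolding U_def by auto
      moreover have "card S = Suc (card (S - {v}))"
        using v psubset by (metis card_Suc_Diff1 finite_subset)
      ultimately have "b ^ card S * card (?P (W - S)) \<le> b * card (?P U)" by simp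
      then show ?thesis using one by linarith
    qed
  qed
qed

lemma chi_cf_le_twice:
  assumes H: "hypergraph V E" "uniform r E" and deg: "\<And>v. v \<in> V \<Longrightarrow> degree E v \<le> \<Delta>"
    and b: "b \<ge> 1" "\<Delta> * (2 ^ r * r ^ r) \<le> b ^ ((r + 1) div 2)"
  shows "chi_cf V E \<le> 2 * b"
proof -
  have "good_colorings E (2 * b) {} = {\<lambda>_. undefined}"
    using H(1) unfolding good_colorings_def hypergraph_def conflict_free_def by auto
  then have "b ^ card V \<le> card (good_colorings E (2 * b) V)"
    using good_colorings_grow[OF assms, of V V] by simp
  then have "card (good_colorings E (2 * b) V) > 0"
    using b(1) by (metis One_nat_def Suc_le_lessD le_trans one_le_power)
  then obtain f where f: "f \<in> good_colorings E (2 * b) V" by (metis card_gt_0_iff ex_in_conv)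
  have "{e \<in> E. e \<subseteq> V} = E" using H(1) unfolding hypergraph_def by auto
  then have "conflict_free E f" "f ` V \<subseteq> {..<2 * b}"
    using f unfolding good_colorings_def by auto
  then have "chi_cf V E \<le> card (f ` V)" by (intro chi_cf_le)
  also have "\<dots> \<le> card {..<2 * b}" using \<open>f ` V \<subseteq> {..<2 * b}\<close> by (intro card_mono) auto
  finally show ?thesis by simp
qed

section \<open>Hypergraphs of pairs with a common sum\<close>

definition mirror :: "nat \<Rightarrow> nat set \<Rightarrow> nat set" where
  "mirror \<sigma> S = S \<union> (\<lambda>a. \<sigma> - a) ` S"

text \<open>
  \<open>S\<close> consists of the smaller elements of the pairs, so that distinct elements of \<open>S\<close> give disjoint
  pairs, and \<open>X\<close> of the vertices outside the pairs.
\<close>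

definition sum_edges :: "nat \<Rightarrow> nat \<Rightarrow> nat \<Rightarrow> nat set set" where
  "sum_edges n s j = {X \<union> mirror \<sigma> S | X \<sigma> S.
     \<sigma> < 2 * n \<and> card S = s \<and> (\<forall>a\<in>S. 2 * a < \<sigma> \<and> \<sigma> - a < n) \<and>
     X \<subseteq> {..<n} \<and> card X = j \<and> X \<inter> mirror \<sigma> S = {}}"

lemma sum_edgesE:
  assumes "e \<in> sum_edges n s j"
  obtains X \<sigma> S where "e = X \<union> mirror \<sigma> S" "\<sigma> < 2 * n" "card S = s"
    "\<forall>a\<in>S. 2 * a < \<sigma> \<and> \<sigma> - a < n" "X \<subseteq> {..<n}" "card X = j" "X \<inter> mirror \<sigma> S = {}"
  using assms unfolding sum_edges_def by (elim CollectE exE conjE) (erule that; simp)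

lemma card_mirror:
  assumes "finite S" "\<And>a. a \<in> S \<Longrightarrow> 2 * a < \<sigma>"
  shows "card (mirror \<sigma> S) = 2 * card S"
proof -
  have "inj_on (\<lambda>a. \<sigma> - a) S" using assms(2) by (intro inj_onI) fastforce
  then have "card ((\<lambda>a. \<sigma> - a) ` S) = card S" by (rule card_image)
  moreover have "S \<inter> (\<lambda>a. \<sigma> - a) ` S = {}"
  proof -
    have "a \<noteq> \<sigma> - b" if "a \<in> S" "b \<in> S" for a b
      using assms(2)[OF that(1)] assms(2)[OF that(2)] by linarith
    then show ?thesis by auto
  qed
  ultimately show ?thesis using assms(1) unfolding mirror_def by (simp add: card_Un_disjoint)
qed

lemma hypergraph_sum_edges:
  assumes "n \<ge> 1" "s \<ge> 1"
  shows "hypergraph {..<n} (sum_edges n s j)" "uniform (2 * s + j) (sum_edges n s j)"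
proof -
  have "e \<subseteq> {..<n} \<and> card e = 2 * s + j" if edge: "e \<in> sum_edges n s j" for e
  proof -
    obtain X \<sigma> S where e: "e = X \<union> mirror \<sigma> S" and S: "\<sigma> < 2 * n" "card S = s"
      "\<forall>a\<in>S. 2 * a < \<sigma> \<and> \<sigma> - a < n" and X: "X \<subseteq> {..<n}" "card X = j" "X \<inter> mirror \<sigma> S = {}"
      using edge by (rule sum_edgesE)
    have sub: "mirror \<sigma> S \<subseteq> {..<n}" using S(3) unfolding mirror_def by fastforce
    have "finite S" using S(2) assms by (intro card_ge_0_finite) auto
    then have "card (mirror \<sigma> S) = 2 * s" using card_mirror S by blast
    then have "card e = 2 * s + j"
      using X sub finite_subset[of _ "{..<n}"] unfolding e by (simp add: card_Un_disjoint)
    then show ?thesis using e X sub by auto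
  qed
  then show "hypergraph {..<n} (sum_edges n s j)" "uniform (2 * s + j) (sum_edges n s j)"
    using assms unfolding hypergraph_def uniform_def by (fastforce simp: lessThan_empty_iff)+
qed

lemma card_subsets_le:
  "finite {S. S \<subseteq> {..<n} \<and> card S = k}" "card {S. S \<subseteq> {..<n::nat} \<and> card S = k} \<le> n ^ k"
proof -
  show "finite {S. S \<subseteq> {..<n} \<and> card S = k}"
    by (rule finite_subset[of _ "Pow {..<n}"]) auto
  have "card {S. S \<subseteq> {..<n::nat} \<and> card S = k} = n choose k" using n_subsets[of "{..<n}" k] by simp
  also have "\<dots> \<le> n ^ k"
    by (cases "k \<le> n") (auto simp: binomial_le_pow binomial_eq_0)
  finally show "card {S. S \<subseteq> {..<n::nat} \<and> card S = k} \<le> n ^ k" .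
qed

text \<open>
  Once \<open>v\<close> is in a pair, the sum \<open>\<sigma>\<close> determines its partner, so the parameters of the edge are \<open>\<sigma>\<close>,
  the other \<open>s - 1\<close> pairs and the \<open>j\<close> vertices outside the pairs. If \<open>v\<close> is the vertex outside
  the pairs, the parameters are \<open>\<sigma>\<close> and the \<open>s\<close> pairs.
\<close>

lemma degree_sum_edges:
  assumes s: "s \<ge> 1" and j: "j \<le> 1"
  shows "degree (sum_edges n s j) v \<le> 4 * n ^ (s + j)"
proof -
  define sub where "sub k = {S. S \<subseteq> {..<n} \<and> card S = k}" for k
  have sub: "finite (sub k)" "card (sub k) \<le> n ^ k" for k
    using card_subsets_le unfolding sub_def by auto
  \<comment> \<open>\<open>A\<close> and \<open>B\<close> cover the edges with \<open>v\<close> outside the pairs and in a pair, respectively.\<close>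
  define A where "A = (if j = 1 then (\<lambda>(\<sigma>, S). insert v (mirror \<sigma> S)) ` ({..<2 * n} \<times> sub s) else {})"
  define B where "B = (\<lambda>(X, \<sigma>, S). X \<union> insert v (insert (\<sigma> - v) (mirror \<sigma> S))) `
    (sub j \<times> {..<2 * n} \<times> sub (s - 1))"
  have "e \<in> A \<union> B" if edge: "e \<in> sum_edges n s j" "v \<in> e" for e
  proof -
    obtain X \<sigma> S where e: "e = X \<union> mirror \<sigma> S" and S: "\<sigma> < 2 * n" "card S = s"
      "\<forall>a\<in>S. 2 * a < \<sigma> \<and> \<sigma> - a < n" and X: "X \<subseteq> {..<n}" "card X = j"
      "X \<inter> mirror \<sigma> S = {}"
      using edge(1) by (rule sum_edgesE)
    have Sn: "S \<subseteq> {..<n}" using S(3) by fastforce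
    have fin: "finite S" "finite X" using Sn X finite_subset by blast+
    show ?thesis
    proof (cases "v \<in> X")
      case True
      then have "j = 1" using X j fin by (metis card_0_eq empty_iff le_antisym less_one not_le)
      then have "X = {v}" using True X by (metis card_1_singletonE singletonD)
      then have "e = insert v (mirror \<sigma> S)" using e by simp
      moreover have "(\<sigma>, S) \<in> {..<2 * n} \<times> sub s" using S Sn unfolding sub_def by auto
      ultimately have "e \<in> A"
        using \<open>j = 1\<close> unfolding A_def by (simp add: image_eqI[where x = "(\<sigma>, S)"])
      then show ?thesis by simp
    next
      case False
      then have "v \<in> mirror \<sigma> S" using edge(2) e by auto
      then obtain a where a: "a \<in> S" "v = a \<or> v = \<sigma> - a" unfolding mirror_def by auto
      have "\<sigma> - (\<sigma> - a) = a" using S(3) a(1) by fastforce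
      then have "{v, \<sigma> - v} = {a, \<sigma> - a}" using a(2) by auto
      moreover have "mirror \<sigma> S = {a, \<sigma> - a} \<union> mirror \<sigma> (S - {a})"
        using a(1) unfolding mirror_def by auto
      ultimately have "mirror \<sigma> S = {v, \<sigma> - v} \<union> mirror \<sigma> (S - {a})" by simp
      then have "mirror \<sigma> S = insert v (insert (\<sigma> - v) (mirror \<sigma> (S - {a})))" by simp
      then have "e = X \<union> insert v (insert (\<sigma> - v) (mirror \<sigma> (S - {a})))" using e by simp
      moreover have "(X, \<sigma>, S - {a}) \<in> sub j \<times> {..<2 * n} \<times> sub (s - 1)"
        using S Sn X a fin unfolding sub_def by auto
      ultimately have "e \<in> B"
        unfolding B_def by (intro image_eqI[where x = "(X, \<sigma>, S - {a})"]) simp_all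
      then show ?thesis by simp
    qed
  qed
  then have "{e \<in> sum_edges n s j. v \<in> e} \<subseteq> A \<union> B" by auto
  moreover have "finite A" "finite B" using sub unfolding A_def B_def by auto
  ultimately have "degree (sum_edges n s j) v \<le> card A + card B"
    unfolding degree_def by (meson card_Un_le card_mono finite_UnI order_trans)
  moreover have "card A \<le> 2 * n ^ (s + j)"
  proof (cases "j = 1")
    case True
    then have "A = (\<lambda>(\<sigma>, S). insert v (mirror \<sigma> S)) ` ({..<2 * n} \<times> sub s)"
      unfolding A_def by simp
    moreover have "finite ({..<2 * n} \<times> sub s)" using sub by simp
    ultimately have "card A \<le> card ({..<2 * n} \<times> sub s)" by (simp only: card_image_le)
    also have "\<dots> \<le> 2 * n * n ^ s" using sub(2) by (simp add: card_cartesian_product)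
    finally show ?thesis using True by (simp add: mult_ac)
  qed (simp add: A_def)
  moreover have "card B \<le> 2 * n ^ (s + j)"
  proof -
    have "card B \<le> card (sub j \<times> {..<2 * n} \<times> sub (s - 1))"
      unfolding B_def using sub by (intro card_image_le) auto
    also have "\<dots> = card (sub j) * (2 * n * card (sub (s - 1)))"
      by (simp add: card_cartesian_product)
    also have "\<dots> \<le> n ^ j * (2 * n * n ^ (s - 1))" using sub(2) by (intro mult_le_mono) auto
    also have "\<dots> = 2 * n ^ (s + j)"
      using s by (cases s) (auto simp: power_add mult_ac)
    finally show ?thesis .
  qed
  ultimately show ?thesis by linarith
qed

text \<open>
  Call a color class large if it has more than \<open>8s\<close> elements. At least half of the vertices lie in
  large classes, so there are at least \<open>4sn\<close> ordered monochromatic pairs there; since there are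
  fewer than \<open>2n\<close> possible sums, some sum is taken by \<open>2s\<close> ordered pairs. Large classes also
  leave room for the vertices outside the pairs.
\<close>

lemma sum_edges_few_colors:
  fixes col :: "nat \<Rightarrow> 'c"
  assumes s: "s \<ge> 1" and j: "j \<le> 1" and n: "n \<ge> 1"
    and cf: "conflict_free (sum_edges n s j) col"
  shows "n < 2 * ((8 * s + 1) * card (col ` {..<n}))"
proof (rule ccontr)
  define q where "q = 8 * s + 1"
  assume "\<not> ?thesis"
  then have few: "2 * (q * card (col ` {..<n})) \<le> n" unfolding q_def by simp
  define cls where "cls x = {y \<in> {..<n}. col y = col x}" for x
  define big where "big = {x \<in> {..<n}. q \<le> card (cls x)}"
  have fin_cls: "finite (cls x)" for x unfolding cls_def by simp
  have fin_big: "finite big" unfolding big_def by simp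
  have small: "card {x \<in> {..<n} - big. col x = c} \<le> q" for c
  proof (cases "{x \<in> {..<n} - big. col x = c} = {}")
    case False
    then obtain x where x: "x \<in> {..<n} - big" "col x = c" by auto
    then have "{x \<in> {..<n} - big. col x = c} \<subseteq> cls x" unfolding cls_def by auto
    then have "card {x \<in> {..<n} - big. col x = c} \<le> card (cls x)" by (rule card_mono[OF fin_cls])
    then show ?thesis using x unfolding big_def by auto
  next
    case True
    then show ?thesis by (metis card.empty zero_le)
  qed
  have "{..<n} - big = (\<Union>c\<in>col ` {..<n}. {x \<in> {..<n} - big. col x = c})" by auto
  then have "card ({..<n} - big) \<le> (\<Sum>c\<in>col ` {..<n}. card {x \<in> {..<n} - big. col x = c})"
    using card_UN_le[of "col ` {..<n}" "\<lambda>c. {x \<in> {..<n} - big. col x = c}"]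
    by (metis finite_imageI finite_lessThan)
  also have "\<dots> \<le> (\<Sum>c\<in>col ` {..<n}. q)" by (intro sum_mono small)
  finally have "card ({..<n} - big) \<le> q * card (col ` {..<n})" by (simp add: mult.commute)
  moreover have "card ({..<n} - big) = n - card big"
    using fin_big card_Diff_subset[of big "{..<n}"] unfolding big_def by auto
  ultimately have half: "n \<le> 2 * card big" using few by linarith
  define pairs where "pairs = (SIGMA x:big. cls x - {x})"
  have fin_pairs: "finite pairs" using fin_big fin_cls unfolding pairs_def by auto
  have "card big * (8 * s) = (\<Sum>x\<in>big. 8 * s)" by simp
  also have "\<dots> \<le> (\<Sum>x\<in>big. card (cls x - {x}))"
  proof (rule sum_mono)
    fix x assume "x \<in> big"
    then have "x \<in> cls x" "q \<le> card (cls x)" unfolding big_def cls_def by auto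
    then show "8 * s \<le> card (cls x - {x})" using fin_cls[of x] unfolding q_def by simp
  qed
  also have "\<dots> = card pairs" unfolding pairs_def using fin_big fin_cls by simp
  finally have many: "card big * (8 * s) \<le> card pairs" .
  have "n * (4 * s) \<le> 2 * card big * (4 * s)" using half by (rule mult_le_mono1)
  also have "\<dots> = card big * (8 * s)" by simp
  also note many
  finally have many: "4 * s * n \<le> card pairs" by (simp only: mult_ac)
  define fibre where "fibre \<sigma> = {p \<in> pairs. fst p + snd p = \<sigma>}" for \<sigma>
  have fin_fibre: "finite (fibre \<sigma>)" for \<sigma> using fin_pairs unfolding fibre_def by simp
  have "\<exists>\<sigma><2 * n. 2 * s \<le> card (fibre \<sigma>)"
  proof (rule ccontr)
    assume "\<not> ?thesis"
    then have le: "card (fibre \<sigma>) \<le> 2 * s - 1" if "\<sigma> < 2 * n" for \<sigma> using that by fastforce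
    have "pairs \<subseteq> (\<Union>\<sigma>\<in>{..<2 * n}. fibre \<sigma>)"
      unfolding fibre_def pairs_def big_def cls_def by auto
    then have "card pairs \<le> card (\<Union>\<sigma>\<in>{..<2 * n}. fibre \<sigma>)"
      using fin_fibre by (intro card_mono) auto
    also have "\<dots> \<le> (\<Sum>\<sigma>\<in>{..<2 * n}. card (fibre \<sigma>))" by (rule card_UN_le) simp
    also have "\<dots> \<le> (\<Sum>\<sigma>\<in>{..<2 * n}. 2 * s - 1)" using le by (intro sum_mono) auto
    also have "\<dots> = 2 * n * (2 * s - 1)" by simp
    also have "\<dots> < 2 * n * (2 * s)" using s n by (intro mult_less_mono2) auto
    finally show False using many by (simp add: mult_ac)
  qed
  then obtain \<sigma> where \<sigma>: "\<sigma> < 2 * n" "2 * s \<le> card (fibre \<sigma>)" by auto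
  \<comment> \<open>Each pair occurs in the fibre in both orders, so it has at least \<open>s\<close> pairs.\<close>
  define L where "L = {a \<in> big. 2 * a < \<sigma> \<and> \<sigma> - a < n \<and> col (\<sigma> - a) = col a}"
  have fin_L: "finite L" using fin_big unfolding L_def by simp
  have "fibre \<sigma> \<subseteq> (\<lambda>a. (a, \<sigma> - a)) ` L \<union> (\<lambda>a. (\<sigma> - a, a)) ` L"
  proof
    fix p assume fib: "p \<in> fibre \<sigma>"
    obtain a b where p: "p = (a, b)" by fastforce
    have a: "a \<in> big" and b: "b < n" "col b = col a" "b \<noteq> a" and ab: "a + b = \<sigma>"
      using fib unfolding p fibre_def pairs_def cls_def by auto
    have "b \<in> big" using a b unfolding big_def cls_def by auto
    moreover have "a < n" using a unfolding big_def by simp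
    ultimately show "p \<in> (\<lambda>a. (a, \<sigma> - a)) ` L \<union> (\<lambda>a. (\<sigma> - a, a)) ` L"
    proof (cases "a < b")
      case True
      then have "a \<in> L" "p = (a, \<sigma> - a)" using a b ab p unfolding L_def by auto
      then show ?thesis by blast
    next
      case False
      then have "b \<in> L" "p = (\<sigma> - b, b)" using \<open>b \<in> big\<close> \<open>a < n\<close> b ab p unfolding L_def by auto
      then show ?thesis by blast
    qed
  qed
  then have "card (fibre \<sigma>) \<le> card ((\<lambda>a. (a, \<sigma> - a)) ` L \<union> (\<lambda>a. (\<sigma> - a, a)) ` L)"
    using fin_L by (intro card_mono) auto
  also have "\<dots> \<le> card L + card L"
    by (intro order_trans[OF card_Un_le] add_mono card_image_le fin_L)
  finally have "s \<le> card L" using \<sigma> by linarith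
  then obtain S where S: "S \<subseteq> L" "card S = s" "finite S" by (rule obtain_subset_with_card_n)
  then obtain a0 where a0: "a0 \<in> S" using s by fastforce
  have cm: "card (mirror \<sigma> S) = 2 * s" using S card_mirror[of S \<sigma>] unfolding L_def by auto
  have "finite (mirror \<sigma> S)" using S unfolding mirror_def by simp
  then have "card (cls a0) - 2 * s \<le> card (cls a0 - mirror \<sigma> S)"
    using cm diff_card_le_card_Diff by metis
  moreover have "q \<le> card (cls a0)" using a0 S unfolding L_def big_def by auto
  ultimately have "j \<le> card (cls a0 - mirror \<sigma> S)" using j unfolding q_def by linarith
  then obtain X where X: "X \<subseteq> cls a0 - mirror \<sigma> S" "card X = j"
    by (rule obtain_subset_with_card_n)
  have "X \<subseteq> {..<n}" "X \<inter> mirror \<sigma> S = {}" using X unfolding cls_def by auto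
  then have "X \<union> mirror \<sigma> S \<in> sum_edges n s j"
    unfolding sum_edges_def using \<sigma> S X unfolding L_def
    by (intro CollectI exI[of _ X] exI[of _ \<sigma>] exI[of _ S] conjI) auto
  then obtain v where v: "v \<in> X \<union> mirror \<sigma> S"
    and unique: "\<And>w. w \<in> X \<union> mirror \<sigma> S \<Longrightarrow> w \<noteq> v \<Longrightarrow> col w \<noteq> col v"
    using cf unfolding conflict_free_def by blast
  have in_mirror: "a \<in> mirror \<sigma> S" "\<sigma> - a \<in> mirror \<sigma> S" "\<sigma> - a \<noteq> a" "col (\<sigma> - a) = col a"
    if "a \<in> S" for a
    using that S unfolding mirror_def L_def by auto
  show False
  proof (cases "v \<in> X")
    case True
    then have "col a0 = col v" "a0 \<noteq> v" using X in_mirror(1)[OF a0] unfolding cls_def by auto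
    then show False using unique[of a0] in_mirror(1)[OF a0] by simp
  next
    case False
    then obtain a where "a \<in> S" "v = a \<or> v = \<sigma> - a" using v unfolding mirror_def by auto
    then show False
      using unique[of a] unique[of "\<sigma> - a"] in_mirror[of a] by auto
  qed
qed

section \<open>Smaller maximum degree\<close>

text \<open>
  A disjoint union with a hypergraph of maximum degree \<open>\<Delta>\<close> raises the maximum degree to \<open>\<Delta>\<close> and
  cannot make conflict-free coloring easier.
\<close>

lemma chi_cf_le_f_cf_if_degree_le:
  fixes V :: "'a set"
  assumes "r \<ge> 2" and H: "hypergraph V E" "uniform r E" and deg: "\<And>v. v \<in> V \<Longrightarrow> degree E v \<le> \<Delta>"
  shows "chi_cf V E \<le> f_cf r \<Delta>"
proof -
  obtain V' :: "nat set" and E' where H': "hypergraph V' E'" "uniform r E'" "max_degree V' E' = \<Delta>"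
    using uniform_hypergraph_exists[OF \<open>r \<ge> 2\<close>] by blast
  define VV where "VV = (Inl ` V \<union> Inr ` V' :: ('a + nat) set)"
  define EE where "EE = ((`) Inl ` E \<union> (`) Inr ` E' :: ('a + nat) set set)"
  have sub: "e \<subseteq> V \<and> e \<noteq> {}" if "e \<in> E" for e
    using that H(1) unfolding hypergraph_def by simp
  have sub': "e \<subseteq> V' \<and> e \<noteq> {}" if "e \<in> E'" for e
    using that H'(1) unfolding hypergraph_def by simp
  have "e \<subseteq> VV \<and> e \<noteq> {}" if "e \<in> EE" for e
  proof -
    consider e0 where "e0 \<in> E" "e = Inl ` e0" | e0 where "e0 \<in> E'" "e = Inr ` e0"
      using \<open>e \<in> EE\<close> unfolding EE_def by auto
    then show ?thesis
    proof cases
      case 1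
      then show ?thesis using sub[of e0] unfolding VV_def by (simp add: image_mono le_supI1)
    next
      case 2
      then show ?thesis using sub'[of e0] unfolding VV_def by (simp add: image_mono le_supI2)
    qed
  qed
  then have hyp: "hypergraph VV EE"
    using H(1) H'(1) unfolding hypergraph_def VV_def by simp
  have uni: "uniform r EE"
    using H H' unfolding uniform_def EE_def by (auto simp: card_image)
  have degl: "degree EE (Inl v) = degree E v" for v
  proof -
    have "{e \<in> EE. Inl v \<in> e} = (`) Inl ` {e \<in> E. v \<in> e}" unfolding EE_def by auto
    then show ?thesis unfolding degree_def by (simp add: card_image inj_on_def inj_image_eq_iff)
  qed
  have degr: "degree EE (Inr v) = degree E' v" for v
  proof -
    have "{e \<in> EE. Inr v \<in> e} = (`) Inr ` {e \<in> E'. v \<in> e}" unfolding EE_def by auto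
    then show ?thesis unfolding degree_def by (simp add: card_image inj_on_def inj_image_eq_iff)
  qed
  have V': "finite V'" "V' \<noteq> {}" using H'(1) unfolding hypergraph_def by auto
  have "\<Delta> \<in> degree E' ` V'"
    unfolding H'(3)[symmetric] max_degree_def using V' by (intro Max_in) auto
  then obtain v' where "v' \<in> V'" "degree E' v' = \<Delta>" by auto
  then have "Inr v' \<in> VV" "degree EE (Inr v') = \<Delta>" using degr unfolding VV_def by auto
  then have "\<Delta> \<in> degree EE ` VV" by blast
  moreover have "x \<le> \<Delta>" if "x \<in> degree EE ` VV" for x
    using that degl degr deg degree_le_max_degree[OF H'(1)] H'(3) unfolding VV_def by auto
  moreover have "finite VV" using hyp unfolding hypergraph_def by simp
  ultimately have max: "max_degree VV EE = \<Delta>" unfolding max_degree_def by (intro Max_eqI) auto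
  obtain col :: "'a + nat \<Rightarrow> nat" where col: "conflict_free EE col" "card (col ` VV) = chi_cf VV EE"
    using chi_cf_attained[OF hyp] by blast
  have "conflict_free E (col \<circ> Inl)"
    unfolding conflict_free_def
  proof
    fix e assume "e \<in> E"
    then have "Inl ` e \<in> EE" unfolding EE_def by simp
    then show "\<exists>v\<in>e. \<forall>w\<in>e. w \<noteq> v \<longrightarrow> (col \<circ> Inl) w \<noteq> (col \<circ> Inl) v"
      using col(1) unfolding conflict_free_def by (auto dest!: bspec[where x = "Inl ` e"])
  qed
  then have "chi_cf V E \<le> card ((col \<circ> Inl) ` V)" by (rule chi_cf_le)
  also have "\<dots> \<le> card (col ` VV)"
    using \<open>finite VV\<close> unfolding VV_def by (intro card_mono) auto
  also have "\<dots> \<le> f_cf r \<Delta>" using col(2) chi_cf_le_f_cf[OF hyp uni max] by simp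
  finally show ?thesis .
qed

section \<open>Choice of the parameters\<close>

lemma f_cf_upper:
  assumes r: "r \<ge> 2" and \<Delta>: "\<Delta> \<ge> 1"
  defines "p \<equiv> 1 / real ((r + 1) div 2)"
  shows "real (f_cf r \<Delta>) \<le> 4 * real (2 ^ r * r ^ r) powr p * real \<Delta> powr p"
proof -
  define t where "t = (r + 1) div 2"
  define K where "K = 2 ^ r * r ^ r"
  define y where "y = real (\<Delta> * K) powr p"
  have t: "t \<ge> 1" using r unfolding t_def by simp
  have K: "K \<ge> 1" using r unfolding K_def by simp
  have "\<Delta> * K \<ge> 1" using K \<Delta> by simp
  then have "real (\<Delta> * K) \<ge> 1" by linarith
  then have "y \<ge> 1" unfolding y_def p_def by (rule ge_one_powr_ge_zero) simp
  define b where "b = nat \<lceil>y\<rceil>"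
  have b: "real b \<ge> y" "real b \<le> 2 * y" using \<open>y \<ge> 1\<close> unfolding b_def by linarith+
  then have "b \<ge> 1" using \<open>y \<ge> 1\<close> by linarith
  have "real (\<Delta> * K) = y ^ t"
    using t \<open>\<Delta> * K \<ge> 1\<close> unfolding y_def p_def t_def[symmetric]
    by (subst powr_realpow[symmetric]) (auto simp: powr_powr)
  also have "\<dots> \<le> real b ^ t" using b \<open>y \<ge> 1\<close> by (intro power_mono) auto
  finally have "\<Delta> * K \<le> b ^ t" by (metis of_nat_le_iff of_nat_power)
  obtain V :: "nat set" and E where H: "hypergraph V E" "uniform r E" "max_degree V E = \<Delta>"
    "chi_cf V E = f_cf r \<Delta>" using f_cf_attained[OF r] by blast
  have "chi_cf V E \<le> 2 * b"
    using \<open>b \<ge> 1\<close> \<open>\<Delta> * K \<le> b ^ t\<close> H degree_le_max_degree[OF H(1)]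
    unfolding K_def t_def by (intro chi_cf_le_twice[of V E r \<Delta>]) auto
  then have "real (f_cf r \<Delta>) \<le> 2 * real b" using H(4) by linarith
  also have "\<dots> \<le> 4 * y" using b by simp
  also have "\<dots> = 4 * real K powr p * real \<Delta> powr p" unfolding y_def by (simp add: powr_mult)
  finally show ?thesis unfolding K_def .
qed

lemma f_cf_lower:
  assumes r: "r \<ge> 2" and \<Delta>: "\<Delta> \<ge> 4"
  defines "p \<equiv> 1 / real ((r + 1) div 2)"
  shows "real \<Delta> powr p \<le> 144 * real r * real (f_cf r \<Delta>)"
proof -
  define t s j where "t = (r + 1) div 2" and "s = r div 2" and "j = r mod 2"
  have t: "t = s + j" "2 * s + j = r" "s \<ge> 1" "j \<le> 1" "t \<ge> 1"
    using r unfolding t_def s_def j_def by presburger+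
  \<comment> \<open>\<open>n\<close> is the largest number for which the degree bound \<open>4 n\<^sup>t\<close> is at most \<open>\<Delta>\<close>.\<close>
  define y where "y = (real \<Delta> / 4) powr p"
  define n where "n = nat \<lfloor>y\<rfloor>"
  have "y \<ge> 1" using \<Delta> unfolding y_def p_def by (intro ge_one_powr_ge_zero) auto
  then have "\<lfloor>y\<rfloor> \<ge> 1" by simp
  then have "real n = of_int \<lfloor>y\<rfloor>" "n \<ge> 1" unfolding n_def by linarith+
  then have n: "real n \<le> y" "y \<le> 2 * real n" "n \<ge> 1" using \<open>\<lfloor>y\<rfloor> \<ge> 1\<close> by linarith+
  have "real n ^ t \<le> y ^ t" using n by (intro power_mono) auto
  also have "\<dots> = real \<Delta> / 4"
    using t \<Delta> unfolding y_def p_def t_def[symmetric]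
    by (subst powr_realpow[symmetric]) (auto simp: powr_powr)
  finally have "real (4 * n ^ t) \<le> real \<Delta>" by simp
  then have deg: "4 * n ^ (s + j) \<le> \<Delta>" using t(1) by (simp only: of_nat_le_iff)
  note H = hypergraph_sum_edges[OF n(3) t(3), of j, unfolded t(2)]
  have "chi_cf {..<n} (sum_edges n s j) \<le> f_cf r \<Delta>"
    using degree_sum_edges[OF t(3,4), of n] deg
    by (intro chi_cf_le_f_cf_if_degree_le[OF r H]) (meson order_trans)
  then have chi: "2 * ((8 * s + 1) * chi_cf {..<n} (sum_edges n s j)) \<le> 2 * ((8 * s + 1) * f_cf r \<Delta>)"
    by (intro mult_le_mono) auto
  obtain col :: "nat \<Rightarrow> nat" where "conflict_free (sum_edges n s j) col"
    "card (col ` {..<n}) = chi_cf {..<n} (sum_edges n s j)" using chi_cf_attained[OF H(1)] by blast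
  then have "n < 2 * ((8 * s + 1) * chi_cf {..<n} (sum_edges n s j))"
    using sum_edges_few_colors[OF t(3,4) n(3), of col] by simp
  then have "n \<le> 2 * ((8 * s + 1) * f_cf r \<Delta>)" using chi by (rule less_imp_le[OF less_le_trans])
  also have "\<dots> \<le> 2 * (9 * r * f_cf r \<Delta>)" using t by (intro mult_le_mono) auto
  finally have "real n \<le> real (2 * (9 * r * f_cf r \<Delta>))" by (rule of_nat_mono)
  then have "real n \<le> 18 * real r * real (f_cf r \<Delta>)" by simp
  moreover have "real \<Delta> powr p \<le> 4 * y"
  proof -
    have "real \<Delta> powr p = 4 powr p * y" unfolding y_def by (simp flip: powr_mult)
    moreover have "(4 :: real) powr p \<le> 4 powr 1"
      using t(5) unfolding p_def t_def[symmetric] by (intro powr_mono) auto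
    ultimately show ?thesis using \<open>y \<ge> 1\<close> by simp
  qed
  ultimately show ?thesis using n by linarith
qed

theorem theorem3:
  fixes r :: nat
  assumes "r \<ge> 3"
  shows "\<exists>c c' d :: real. c > 0 \<and> c' > 0 \<and> d > 0 \<and>
    (\<forall>\<Delta> :: nat. real \<Delta> > d \<longrightarrow>
       c * (real \<Delta> powr (1 / real_of_int \<lceil>real r / 2\<rceil>) / ln (real \<Delta>)) \<le> real (f_cf r \<Delta>) \<and>
       real (f_cf r \<Delta>) \<le> c' * real \<Delta> powr (1 / real_of_int \<lceil>real r / 2\<rceil>))"
proof -
  have ceil: "\<lceil>real r / 2\<rceil> = int ((r + 1) div 2)"
    by (rule ceiling_unique) (cases "even r"; auto elim!: evenE oddE)+
  define p where "p = 1 / real ((r + 1) div 2)"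
  have p: "1 / real_of_int \<lceil>real r / 2\<rceil> = p" unfolding ceil p_def by simp
  define c c' where "c = 1 / (144 * real r)" and "c' = 4 * real (2 ^ r * r ^ r) powr p"
  have pos: "c > 0" "c' > 0" using assms unfolding c_def c'_def by auto
  have "c * (real \<Delta> powr p / ln (real \<Delta>)) \<le> real (f_cf r \<Delta>) \<and>
    real (f_cf r \<Delta>) \<le> c' * real \<Delta> powr p" if "real \<Delta> > 4" for \<Delta>
  proof -
    have \<Delta>: "\<Delta> \<ge> 4" using that by linarith
    have "exp 1 \<le> real \<Delta>" using exp_le that by linarith
    then have "1 \<le> ln (real \<Delta>)" using that by (subst ln_ge_iff) auto
    then have "real \<Delta> powr p / ln (real \<Delta>) \<le> real \<Delta> powr p / 1" by (intro divide_left_mono) auto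
    then have "c * (real \<Delta> powr p / ln (real \<Delta>)) \<le> c * real \<Delta> powr p"
      using pos by (intro mult_left_mono) auto
    also have "\<dots> \<le> real (f_cf r \<Delta>)"
      using f_cf_lower[OF _ \<Delta>, of r] assms unfolding c_def p_def by (simp add: field_simps)
    finally show ?thesis
      using f_cf_upper[of r \<Delta>] assms \<Delta> unfolding c'_def p_def by auto
  qed
  then show ?thesis unfolding p using pos by (intro exI[of _ c] exI[of _ c'] exI[of _ 4]) auto
qed

end
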